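(* $$\text{\ae}(3)=\frac{4}{3}.$$
   Context: All Banach spaces are real; subsets of metric spaces carry the induced metric. For metric spaces $X\subset Y$, a Banach space $E$ and a Lipschitz map $f\colon X\to E$ with optimal Lipschitz constant $\mathrm{Lip}(f)$, let $e(X,Y,E,f)$ be the infimum of those $K\ge 0$ for which there is a $K\,\mathrm{Lip}(f)$-Lipschitz map $\bar f\colon Y\to E$ extending $f$. Put $\nu(X,Y):=\sup\{e(X,Y,E,f): E\text{ a Banach space}, f\colon X\to E\text{ Lipschitz}\}$, $\text{\ae}(X):=\sup\{\nu(X,Y): Y\supset X\text{ a metric space}\}$, and $\text{\ae}(n):=\sup\{\text{\ae}(X): X\text{ a metric space with }|X|=n\}$. *)

theory Defs
  imports "HOL-Analysis.Analysis"
begin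

text \<open>
  A Banach space is a pair \<open>(V, N)\<close> of a linear subspace \<open>V\<close> of an ambient real vector space
  \<open>'e\<close>, which has no norm of its own, and a complete norm \<open>N\<close> on \<open>V\<close>. Only the values of \<open>N\<close> on
  \<open>V\<close> matter; the metric is cut off outside \<open>V\<close> because \<^locale>\<open>Metric_space\<close> demands nonnegativity
  and symmetry on the whole type.
\<close>

definition norm_metric :: "'e::real_vector set \<Rightarrow> ('e \<Rightarrow> real) \<Rightarrow> 'e metric" where
  "norm_metric V N = metric (V, \<lambda>x y. if x \<in> V \<and> y \<in> V then N (x - y) else 0)"

definition norm_on :: "'e::real_vector set \<Rightarrow> ('e \<Rightarrow> real) \<Rightarrow> bool" where
  "norm_on V N \<longleftrightarrow> subspace V
     \<and> (\<forall>x\<in>V. 0 \<le> N x \<and> (N x = 0 \<longleftrightarrow> x = 0))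
     \<and> (\<forall>x\<in>V. \<forall>c. N (c *\<^sub>R x) = \<bar>c\<bar> * N x)
     \<and> (\<forall>x\<in>V. \<forall>y\<in>V. N (x + y) \<le> N x + N y)"

definition banach_on :: "'e::real_vector set \<Rightarrow> ('e \<Rightarrow> real) \<Rightarrow> bool" where
  "banach_on V N \<longleftrightarrow> norm_on V N \<and> mcomplete_of (norm_metric V N)"

lemma norm_on_Metric_space:
  assumes "norm_on V N"
  shows "Metric_space V (\<lambda>x y. if x \<in> V \<and> y \<in> V then N (x - y) else 0)"
proof
  have V: "subspace V" and nn: "\<And>x. x \<in> V \<Longrightarrow> 0 \<le> N x"
    and z: "\<And>x. x \<in> V \<Longrightarrow> N x = 0 \<longleftrightarrow> x = 0"
    and sc: "\<And>x c. x \<in> V \<Longrightarrow> N (c *\<^sub>R x) = \<bar>c\<bar> * N x"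
    and tr: "\<And>x y. x \<in> V \<Longrightarrow> y \<in> V \<Longrightarrow> N (x + y) \<le> N x + N y"
    using assms by (auto simp: norm_on_def)
  note d = subspace_diff[OF V]
  fix x y z :: 'a
  show "0 \<le> (if x \<in> V \<and> y \<in> V then N (x - y) else 0)"
    using nn d by auto
  show "(if x \<in> V \<and> y \<in> V then N (x - y) else 0) = (if y \<in> V \<and> x \<in> V then N (y - x) else 0)"
    using sc[of "x - y" "-1"] d by auto
  show "((if x \<in> V \<and> y \<in> V then N (x - y) else 0) = 0) = (x = y)" if "x \<in> V" "y \<in> V"
    using that z d by auto
  show "(if x \<in> V \<and> z \<in> V then N (x - z) else 0)
      \<le> (if x \<in> V \<and> y \<in> V then N (x - y) else 0) + (if y \<in> V \<and> z \<in> V then N (y - z) else 0)"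
    if "x \<in> V" "y \<in> V" "z \<in> V"
    using that tr[of "x - y" "y - z"] d by auto
qed

lemma mspace_norm_metric: "norm_on V N \<Longrightarrow> mspace (norm_metric V N) = V"
  by (simp add: norm_metric_def Metric_space.mspace_metric norm_on_Metric_space)

lemma mdist_norm_metric:
  "norm_on V N \<Longrightarrow> x \<in> V \<Longrightarrow> y \<in> V \<Longrightarrow> mdist (norm_metric V N) x y = N (x - y)"
  by (simp add: norm_metric_def Metric_space.mdist_metric norm_on_Metric_space)

text \<open>
  The Banach spaces of the type class \<open>banach\<close> are covered, up to linear isometry, as soon as the
  ambient vector space is large enough.
\<close>

lemma banach_on_range:
  fixes T :: "'b::banach \<Rightarrow> 'e::real_vector"
  assumes T: "linear T" and "inj T"
  shows "banach_on (range T) (\<lambda>v. norm (inv T v))"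
proof -
  let ?N = "\<lambda>v. norm (inv T v)"
  have i: "inv T (T x) = x" for x
    using \<open>inj T\<close> by simp
  have n: "norm_on (range T) ?N"
    unfolding norm_on_def
  proof (intro conjI ballI allI)
    show "subspace (range T)"
      by (simp add: T linear_subspace_image)
    fix x assume "x \<in> range T"
    then obtain a where a: "x = T a" by auto
    show "0 \<le> ?N x" by simp
    show "?N x = 0 \<longleftrightarrow> x = 0"
      using a i T \<open>inj T\<close> by (metis linear_0 norm_eq_zero)
    show "?N (c *\<^sub>R x) = \<bar>c\<bar> * ?N x" for c
      using a i linear_scale[OF T] by (metis norm_scaleR)
    fix y assume "y \<in> range T"
    then obtain b where b: "y = T b" by auto
    have "inv T (x + y) = a + b"
      by (metis a b i linear_add[OF T])
    then show "?N (x + y) \<le> ?N x + ?N y"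
      by (simp add: a b i norm_triangle_ineq)
  qed
  have dd: "mdist (norm_metric (range T) ?N) (T a) (T b) = dist a b" for a b
    using mdist_norm_metric[OF n] i by (metis dist_norm linear_diff[OF T] rangeI)
  interpret M: Metric_space "range T" "mdist (norm_metric (range T) ?N)"
    using Metric_space_mspace_mdist mspace_norm_metric[OF n] by metis
  have "M.mcomplete"
    unfolding M.mcomplete_def
  proof (intro allI impI)
    fix s assume s: "M.MCauchy s"
    define a where "a n = inv T (s n)" for n
    have sa: "s n = T (a n)" for n
      using s unfolding M.MCauchy_def a_def by (metis f_inv_into_f rangeI subsetD)
    have "Cauchy a"
      using s unfolding M.MCauchy_def Cauchy_def sa dd by meson
    then obtain l where l: "a \<longlonglongrightarrow> l"
      using Cauchy_convergent convergent_def by blast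
    then have "limitin M.mtopology s (T l) sequentially"
      unfolding M.limit_metric_sequentially sa dd by (auto simp: lim_sequentially)
    then show "\<exists>x. limitin M.mtopology s x sequentially" ..
  qed
  then show ?thesis
    using n by (simp add: banach_on_def mcomplete_of_def mspace_norm_metric)
qed

definition lipschitz_map :: "real \<Rightarrow> 'a metric \<Rightarrow> 'b metric \<Rightarrow> ('a \<Rightarrow> 'b) \<Rightarrow> bool" where
  "lipschitz_map L X E f \<longleftrightarrow> f \<in> mspace X \<rightarrow> mspace E
     \<and> (\<forall>x\<in>mspace X. \<forall>y\<in>mspace X. mdist E (f x) (f y) \<le> L * mdist X x y)"

definition Lip :: "'a metric \<Rightarrow> 'b metric \<Rightarrow> ('a \<Rightarrow> 'b) \<Rightarrow> real" where
  "Lip X E f = Inf {L. 0 \<le> L \<and> lipschitz_map L X E f}"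

definition metric_extension :: "'a metric \<Rightarrow> 'a metric \<Rightarrow> bool" where
  "metric_extension X Y \<longleftrightarrow> mspace X \<subseteq> mspace Y
     \<and> (\<forall>x\<in>mspace X. \<forall>y\<in>mspace X. mdist X x y = mdist Y x y)"

definition ext_const :: "'a metric \<Rightarrow> 'a metric \<Rightarrow> 'b metric \<Rightarrow> ('a \<Rightarrow> 'b) \<Rightarrow> ennreal" where
  "ext_const X Y E f = Inf {ennreal K | K. 0 \<le> K
     \<and> (\<exists>g. lipschitz_map (K * Lip X E f) Y E g \<and> (\<forall>x\<in>mspace X. g x = f x))}"

text \<open>
  HOL has no supremum over all Banach spaces or all metric spaces, so the suprema below are relative
  to universes: Banach spaces are subspaces of \<open>'e\<close> in the sense above, metric spaces have their
  points in \<open>'a\<close>. For finite \<open>X\<close> and infinite \<open>'a\<close>, every metric space containing \<open>X\<close> of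
  cardinality at most that of \<open>'a\<close> is isometric, relative to \<open>X\<close>, to one with points in \<open>'a\<close>.
\<close>

definition nu :: "'e::real_vector itself \<Rightarrow> 'a metric \<Rightarrow> 'a metric \<Rightarrow> ennreal" where
  "nu U X Y = Sup {ext_const X Y (norm_metric V N) f | (V :: 'e set) N f.
     banach_on V N \<and> Lipschitz_continuous_map X (norm_metric V N) f}"

definition ae_space :: "'e::real_vector itself \<Rightarrow> 'a metric \<Rightarrow> ennreal" where
  "ae_space U X = Sup {nu U X Y | Y. metric_extension X Y}"

definition ae :: "'a itself \<Rightarrow> 'e::real_vector itself \<Rightarrow> nat \<Rightarrow> ennreal" where
  "ae T U n = Sup {ae_space U X | X :: 'a metric. finite (mspace X) \<and> card (mspace X) = n}"

end

theory Submission
  imports Defs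
begin

text \<open>
  Upper bound. Three points \<open>x\<^sub>1, x\<^sub>2, x\<^sub>3\<close> with Gromov products \<open>a\<^sub>1, a\<^sub>2, a\<^sub>3\<close> satisfy
  \<open>d x\<^sub>i x\<^sub>j = a\<^sub>i + a\<^sub>j\<close>, so they are the end points of a tripod with legs of lengths \<open>a\<^sub>i\<close>, and every
  metric space containing them maps to this tripod without increasing distances. It is therefore
  enough to find an image \<open>p\<close> of the centre with \<open>\<parallel>f x\<^sub>i - p\<parallel> \<le> 4/3 * L * a\<^sub>i\<close>, where \<open>L\<close> is the Lipschitz
  constant of \<open>f\<close>, and to extend affinely along the legs. A barycentre of the points \<open>f x\<^sub>i\<close> with
  suitable weights (\<open>tripod_weights\<close>) is such a \<open>p\<close>; the constant \<open>4/3\<close> comes from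
  \<open>(a\<^sub>1 + a\<^sub>2) (a\<^sub>2 + a\<^sub>3) (a\<^sub>3 + a\<^sub>1) \<ge> 8 a\<^sub>1 a\<^sub>2 a\<^sub>3\<close>. The composite of the map to the tripod with the
  affine extension has a closed form, given in \<open>star_extension\<close>, so the tripod itself never occurs.

  Lower bound. Let \<open>X\<close> be three points at mutual distance 2 and add a centre at distance 1 from
  each. Map \<open>X\<close> isometrically to the standard basis vectors of \<open>\<ell>\<^sub>1\<^sup>3\<close>, regarded as points of
  the plane on which the coordinates have sum 1. For every point of this plane the three distances
  to the basis vectors add up to at least 4, so one of them is at least \<open>4/3\<close>, and the centre cannot
  be mapped with a smaller Lipschitz constant.
\<close>

section \<open>Norms on subspaces and optimal Lipschitz constants\<close>

lemma norm_on_sum_scaleR_le: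
  assumes n: "norm_on V N" and "finite I" and "\<And>i. i \<in> I \<Longrightarrow> v i \<in> V"
  shows "N (\<Sum>i\<in>I. c i *\<^sub>R v i) \<le> (\<Sum>i\<in>I. \<bar>c i\<bar> * N (v i))"
  using assms(2,3)
proof (induction I)
  case empty
  have "N 0 = 0" using n by (meson norm_on_def subspace_0)
  then show ?case by simp
next
  case (insert i I)
  have V: "subspace V" using n by (simp add: norm_on_def)
  have "(\<Sum>i\<in>I. c i *\<^sub>R v i) \<in> V" "c i *\<^sub>R v i \<in> V"
    using insert V by (auto intro!: subspace_sum subspace_scale)
  then have "N (c i *\<^sub>R v i + (\<Sum>i\<in>I. c i *\<^sub>R v i)) \<le> N (c i *\<^sub>R v i) + N (\<Sum>i\<in>I. c i *\<^sub>R v i)"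
    using n by (auto simp: norm_on_def)
  moreover have "N (c i *\<^sub>R v i) = \<bar>c i\<bar> * N (v i)"
    using n insert by (auto simp: norm_on_def)
  ultimately show ?case using insert by simp
qed

text \<open>
  The infimum defining the optimal Lipschitz constant is attained, because each of the inequalities
  that it ranges over is a closed condition on the constant.
\<close>

lemma Lip_lipschitz_map:
  assumes "lipschitz_map L X E f"
  shows "lipschitz_map (Lip X E f) X E f" and "0 \<le> Lip X E f"
proof -
  let ?S = "{L. 0 \<le> L \<and> lipschitz_map L X E f}"
  have "lipschitz_map (max 0 L) X E f"
    using assms unfolding lipschitz_map_def
    by (meson max.cobounded2 mult_right_mono mdist_nonneg order_trans)
  then have ne: "?S \<noteq> {}" by (auto intro!: exI[of _ "max 0 L"])
  show "0 \<le> Lip X E f"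
    unfolding Lip_def by (rule cInf_greatest[OF ne]) auto
  have "mdist E (f x) (f y) \<le> Lip X E f * mdist X x y" if xy: "x \<in> mspace X" "y \<in> mspace X" for x y
  proof (cases "mdist X x y = 0")
    case True
    then show ?thesis using assms xy unfolding lipschitz_map_def by (metis mult_zero_right)
  next
    case False
    then have pos: "0 < mdist X x y" by (simp add: order_less_le)
    have "mdist E (f x) (f y) / mdist X x y \<le> Lip X E f"
      unfolding Lip_def
      by (rule cInf_greatest[OF ne]) (use xy pos in \<open>auto simp: lipschitz_map_def divide_le_eq\<close>)
    then show ?thesis using pos by (simp add: divide_le_eq)
  qed
  then show "lipschitz_map (Lip X E f) X E f"
    using assms by (simp add: lipschitz_map_def)
qed

lemma Lip_le:
  assumes "0 \<le> L" "lipschitz_map L X E f"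
  shows "Lip X E f \<le> L"
  unfolding Lip_def by (rule cInf_lower) (use assms in \<open>auto intro: bdd_belowI[of _ 0]\<close>)

section \<open>Extension along a star\<close>

text \<open>
  The number \<open>max 0 (a x - d x y)\<close> is the distance from the centre at which \<open>y\<close> is placed on the leg
  towards \<open>x\<close>. The open balls of radius \<open>a x\<close> around the points \<open>x\<close> are disjoint, so \<open>y\<close> is
  placed on at most one leg, and the sum below is the distance of two points of the star.
\<close>

lemma star_retraction_nonexpansive:
  assumes X: "finite X" "X \<noteq> {}" "X \<subseteq> mspace Y"
    and packing: "\<And>x x'. x \<in> X \<Longrightarrow> x' \<in> X \<Longrightarrow> x \<noteq> x' \<Longrightarrow> a x + a x' \<le> mdist Y x x'"
    and yz: "y \<in> mspace Y" "z \<in> mspace Y"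
  shows "(\<Sum>x\<in>X. \<bar>max 0 (a x - mdist Y x y) - max 0 (a x - mdist Y x z)\<bar>) \<le> mdist Y y z"
proof -
  define r where "r x w = max 0 (a x - mdist Y x w)" for x w
  have tri: "mdist Y u w \<le> mdist Y u v + mdist Y v w"
    if "u \<in> mspace Y" "v \<in> mspace Y" "w \<in> mspace Y" for u v w
    using that by (rule mdist_triangle)
  have leg: "\<exists>u\<in>X. \<forall>x\<in>X. x \<noteq> u \<longrightarrow> r x w = 0" if w: "w \<in> mspace Y" for w
  proof (cases "\<exists>u\<in>X. 0 < r u w")
    case True
    then obtain u where u: "u \<in> X" "0 < r u w" by blast
    have "r x w = 0" if "x \<in> X" "x \<noteq> u" for x
    proof -
      have "a x + a u \<le> mdist Y x w + mdist Y u w"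
        using packing[OF that(1) u(1) that(2)] tri[of x w u] subsetD[OF X(3) that(1)]
          subsetD[OF X(3) u(1)] w by (simp add: mdist_commute[of Y w u])
      then show ?thesis using u by (auto simp: r_def)
    qed
    then show ?thesis using u by blast
  next
    case False
    then have "\<forall>x\<in>X. r x w = 0" by (force simp: r_def)
    then show ?thesis using X by blast
  qed
  obtain u where u: "u \<in> X" "\<And>x. x \<in> X \<Longrightarrow> x \<noteq> u \<Longrightarrow> r x y = 0" using leg yz by blast
  obtain v where v: "v \<in> X" "\<And>x. x \<in> X \<Longrightarrow> x \<noteq> v \<Longrightarrow> r x z = 0" using leg yz by blast
  have "(\<Sum>x\<in>X. \<bar>r x y - r x z\<bar>) = (\<Sum>x\<in>{u, v}. \<bar>r x y - r x z\<bar>)"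
    by (rule sum.mono_neutral_right) (use X u v in auto)
  also have "\<dots> \<le> mdist Y y z"
  proof -
    have uv: "u \<in> mspace Y" "v \<in> mspace Y" using u v X by auto
    note t = tri[of u y z] tri[of u z y] tri[of v y z] tri[of v z y] mdist_commute[of Y y z]
    show ?thesis
    proof (cases "u = v")
      case True
      then show ?thesis using t uv yz by (simp add: r_def)
    next
      case False
      have "r v y = 0" "r u z = 0" using False u v by auto
      moreover have "a u + a v \<le> mdist Y u y + mdist Y y z + mdist Y v z"
        using packing[of u v] False u v tri[of u y v] tri[of y z v] uv yz
        by (simp add: mdist_commute[of Y z v])
      ultimately show ?thesis using t uv yz False by (simp add: r_def)
    qed
  qed
  finally show ?thesis by (simp add: r_def)
qed

text \<open>
  The extension sends the centre of the star to \<open>p\<close> and is affine on each leg. A leg of length 0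
  causes no division problem, because then \<open>f x = p\<close> and the numerator vanishes as well.
\<close>

lemma star_extension:
  assumes n: "norm_on V N"
    and X: "finite X" "X \<noteq> {}" "X \<subseteq> mspace Y"
    and f: "f \<in> X \<rightarrow> V" and p: "p \<in> V" and K: "0 \<le> K"
    and a: "\<And>x. x \<in> X \<Longrightarrow> 0 \<le> a x"
    and packing: "\<And>x x'. x \<in> X \<Longrightarrow> x' \<in> X \<Longrightarrow> x \<noteq> x' \<Longrightarrow> a x + a x' \<le> mdist Y x x'"
    and centre: "\<And>x. x \<in> X \<Longrightarrow> N (f x - p) \<le> K * a x"
  shows "\<exists>g. lipschitz_map K Y (norm_metric V N) g \<and> (\<forall>x\<in>X. g x = f x)"
proof -
  have V: "subspace V" using n by (simp add: norm_on_def)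
  have fp: "f x - p \<in> V" if "x \<in> X" for x using f p V that by (auto intro: subspace_diff)
  define r where "r x y = max 0 (a x - mdist Y x y)" for x y
  define g where "g y = p + (\<Sum>x\<in>X. (r x y / a x) *\<^sub>R (f x - p))" for y
  have gV: "g y \<in> V" for y
    unfolding g_def using V p fp by (intro subspace_add subspace_sum subspace_scale) auto
  have "g x = f x" if x: "x \<in> X" for x
  proof -
    have "r x' x = 0" if "x' \<in> X" "x' \<noteq> x" for x'
      using packing[of x' x] a[of x] x that by (simp add: r_def)
    then have "(\<Sum>x'\<in>X. (r x' x / a x') *\<^sub>R (f x' - p)) = (\<Sum>x'\<in>{x}. (r x' x / a x') *\<^sub>R (f x' - p))"
      by (intro sum.mono_neutral_right) (use X x in auto)
    also have "\<dots> = f x - p"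
    proof (cases "a x = 0")
      case True
      then have "N (f x - p) = 0" using centre[OF x] fp[OF x] n by (force simp: norm_on_def)
      then have "f x - p = 0" using fp[OF x] n unfolding norm_on_def by blast
      then show ?thesis by simp
    next
      case False
      moreover have "r x x = a x" using a[OF x]
        mdist_zero[OF subsetD[OF X(3) x] subsetD[OF X(3) x], THEN iffD2, OF refl]
        by (simp add: r_def)
      ultimately show ?thesis by simp
    qed
    finally show ?thesis by (simp add: g_def)
  qed
  moreover have "N (g y - g z) \<le> K * mdist Y y z" if yz: "y \<in> mspace Y" "z \<in> mspace Y" for y z
  proof -
    have "g y - g z = (\<Sum>x\<in>X. ((r x y - r x z) / a x) *\<^sub>R (f x - p))"
      by (simp add: g_def sum_subtractf[symmetric] scaleR_left_diff_distrib diff_divide_distrib)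
    then have "N (g y - g z) \<le> (\<Sum>x\<in>X. \<bar>(r x y - r x z) / a x\<bar> * N (f x - p))"
      by (simp only: norm_on_sum_scaleR_le[OF n X(1) fp])
    also have "\<dots> \<le> (\<Sum>x\<in>X. K * \<bar>r x y - r x z\<bar>)"
    proof (rule sum_mono)
      fix x assume x: "x \<in> X"
      have "\<bar>(r x y - r x z) / a x\<bar> * N (f x - p) \<le> \<bar>(r x y - r x z) / a x\<bar> * (K * a x)"
        by (rule mult_left_mono[OF centre[OF x]]) simp
      also have "\<dots> \<le> K * \<bar>r x y - r x z\<bar>"
        using a[OF x] K by (cases "a x = 0") (auto simp: abs_divide)
      finally show "\<bar>(r x y - r x z) / a x\<bar> * N (f x - p) \<le> K * \<bar>r x y - r x z\<bar>" .
    qed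
    also have "\<dots> \<le> K * mdist Y y z"
      unfolding sum_distrib_left[symmetric]
      using star_retraction_nonexpansive[OF X packing yz] K by (simp add: r_def mult_left_mono)
    finally show ?thesis .
  qed
  ultimately show ?thesis
    using gV by (intro exI[of _ g]) (auto simp: lipschitz_map_def mspace_norm_metric[OF n] mdist_norm_metric[OF n])
qed

section \<open>The upper bound\<close>

text \<open>
  For positive leg lengths the weights are proportional to \<open>(b + c) / a\<close>, \<open>(c + a) / b\<close>, \<open>(a + b) / c\<close>;
  they are the ones for which the three ratios of left-hand side to leg length agree. Multiplying
  them by \<open>a b c\<close> gives formulas that still work when one leg has length 0. With \<open>P = (a + b) (b + c) (c + a)\<close>, the
  common ratio is \<open>P / (P - 2 a b c)\<close>, and \<open>P \<ge> 8 a b c\<close> bounds it by \<open>4/3\<close>.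
\<close>

lemma tripod_weights:
  fixes a b c :: real
  assumes nn: "0 \<le> a" "0 \<le> b" "0 \<le> c" and pos: "0 < a + b" "0 < b + c" "0 < c + a"
  obtains l m n where "0 \<le> l" "0 \<le> m" "0 \<le> n" "l + m + n = 1"
    "m * (a + b) + n * (c + a) \<le> 4/3 * a"
    "l * (a + b) + n * (b + c) \<le> 4/3 * b"
    "l * (c + a) + m * (b + c) \<le> 4/3 * c"
proof -
  define P where "P = (a + b) * (b + c) * (c + a)"
  define Q where "Q = b * c * (b + c) + c * a * (c + a) + a * b * (a + b)"
  have PQ: "P = Q + 2 * (a * b * c)"
    by (simp add: P_def Q_def algebra_simps)
  have "P - 8 * (a * b * c) = a * (b - c)\<^sup>2 + b * (c - a)\<^sup>2 + c * (a - b)\<^sup>2"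
    by (simp add: P_def power2_eq_square algebra_simps)
  also have "\<dots> \<ge> 0" using nn by simp
  finally have P8: "8 * (a * b * c) \<le> P" by simp
  have "0 < P" unfolding P_def using pos by simp
  then have Q: "0 < Q" using P8 PQ by linarith
  have ratio: "P / Q \<le> 4/3" using P8 PQ Q by (simp add: divide_le_eq)
  show thesis
  proof
    show "0 \<le> b * c * (b + c) / Q" "0 \<le> c * a * (c + a) / Q" "0 \<le> a * b * (a + b) / Q"
      using nn Q by auto
    show "b * c * (b + c) / Q + c * a * (c + a) / Q + a * b * (a + b) / Q = 1"
      using Q by (simp add: add_divide_distrib[symmetric] Q_def)
    have "c * a * (c + a) / Q * (a + b) + a * b * (a + b) / Q * (c + a) = P / Q * a"
      by (simp add: P_def add_divide_distrib[symmetric]) (simp add: algebra_simps)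
    then show "c * a * (c + a) / Q * (a + b) + a * b * (a + b) / Q * (c + a) \<le> 4/3 * a"
      using mult_right_mono[OF ratio nn(1)] by simp
    have "b * c * (b + c) / Q * (a + b) + a * b * (a + b) / Q * (b + c) = P / Q * b"
      by (simp add: P_def add_divide_distrib[symmetric]) (simp add: algebra_simps)
    then show "b * c * (b + c) / Q * (a + b) + a * b * (a + b) / Q * (b + c) \<le> 4/3 * b"
      using mult_right_mono[OF ratio nn(2)] by simp
    have "b * c * (b + c) / Q * (c + a) + c * a * (c + a) / Q * (b + c) = P / Q * c"
      by (simp add: P_def add_divide_distrib[symmetric]) (simp add: algebra_simps)
    then show "b * c * (b + c) / Q * (c + a) + c * a * (c + a) / Q * (b + c) \<le> 4/3 * c"
      using mult_right_mono[OF ratio nn(3)] by simp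
  qed
qed

lemma three_point_lipschitz_extension:
  assumes n: "norm_on V N" and X: "card (mspace X) = 3" and ext: "metric_extension X Y"
    and f: "lipschitz_map L X (norm_metric V N) f" and L: "0 \<le> L"
  shows "\<exists>g. lipschitz_map (4/3 * L) Y (norm_metric V N) g \<and> (\<forall>x\<in>mspace X. g x = f x)"
proof -
  obtain x y z where xyz: "mspace X = {x, y, z}" "x \<noteq> y" "x \<noteq> z" "y \<noteq> z"
    using X by (auto simp: card_3_iff)
  let ?d = "mdist Y"
  have Y: "x \<in> mspace Y" "y \<in> mspace Y" "z \<in> mspace Y"
    using ext xyz by (auto simp: metric_extension_def)
  have V: "subspace V" using n by (simp add: norm_on_def)
  have fV: "f x \<in> V" "f y \<in> V" "f z \<in> V"
    using f xyz by (auto simp: lipschitz_map_def mspace_norm_metric[OF n])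
  have fL: "N (f u - f v) \<le> L * ?d u v" if "u \<in> mspace X" "v \<in> mspace X" for u v
  proof -
    have "f u \<in> V" "f v \<in> V" using that fV xyz by auto
    then have "N (f u - f v) = mdist (norm_metric V N) (f u) (f v)"
      by (simp add: mdist_norm_metric[OF n])
    also have "\<dots> \<le> L * mdist X u v"
      using f that by (simp add: lipschitz_map_def)
    also have "mdist X u v = ?d u v"
      using ext that by (simp add: metric_extension_def)
    finally show ?thesis .
  qed
  (* The Gromov products are the leg lengths of the tripod spanned by x, y, z. *)
  define a where "a = (?d x y + ?d x z - ?d y z) / 2"
  define b where "b = (?d x y + ?d y z - ?d x z) / 2"
  define c where "c = (?d x z + ?d y z - ?d x y) / 2"
  have sums: "?d x y = a + b" "?d y z = b + c" "?d x z = c + a"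
    by (simp_all add: a_def b_def c_def field_simps)
  have comm: "?d y x = ?d x y" "?d z x = ?d x z" "?d z y = ?d y z"
    by (simp_all add: mdist_commute)
  have nn: "0 \<le> a" "0 \<le> b" "0 \<le> c"
    using mdist_triangle[of y Y x z] mdist_triangle[of x Y y z] mdist_triangle[of x Y z y] Y comm
    by (simp_all add: a_def b_def c_def)
  have "0 < ?d x y" "0 < ?d y z" "0 < ?d x z"
    using Y xyz by (simp_all add: order_less_le)
  then have pos: "0 < a + b" "0 < b + c" "0 < c + a"
    unfolding sums .
  obtain l m k where lmk: "0 \<le> l" "0 \<le> m" "0 \<le> k" "l + m + k = 1"
    and bounds: "m * (a + b) + k * (c + a) \<le> 4/3 * a"
      "l * (a + b) + k * (b + c) \<le> 4/3 * b"
      "l * (c + a) + m * (b + c) \<le> 4/3 * c"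
    by (rule tripod_weights[OF nn pos])
  define p where "p = l *\<^sub>R f x + m *\<^sub>R f y + k *\<^sub>R f z"
  have pV: "p \<in> V"
    unfolding p_def using V fV by (intro subspace_add subspace_scale)
  have N2: "N (s *\<^sub>R v + t *\<^sub>R w) \<le> s * N v + t * N w"
    if "v \<in> V" "w \<in> V" "0 \<le> s" "0 \<le> t" for s t v w
  proof -
    have "N (s *\<^sub>R v + t *\<^sub>R w) \<le> N (s *\<^sub>R v) + N (t *\<^sub>R w)"
      using n subspace_scale[OF V that(1), of s] subspace_scale[OF V that(2), of t]
      by (simp add: norm_on_def)
    also have "\<dots> = s * N v + t * N w"
      using n that by (auto simp: norm_on_def)
    finally show ?thesis .
  qed
  (* Each point f u differs from the barycentre p by a combination of the two other sides. *)
  have near: "N (f u - p) \<le> 4/3 * L * e"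
    if p: "f u - p = s *\<^sub>R (f u - f v) + t *\<^sub>R (f u - f w)"
      and st: "0 \<le> s" "0 \<le> t" and e: "s * ?d u v + t * ?d u w \<le> 4/3 * e"
      and uvw: "u \<in> {x, y, z}" "v \<in> {x, y, z}" "w \<in> {x, y, z}" for u v w s t e
  proof -
    have "N (f u - p) \<le> s * N (f u - f v) + t * N (f u - f w)"
    proof -
      have "f u \<in> V" "f v \<in> V" "f w \<in> V" using uvw fV by auto
      then show ?thesis
        unfolding p by (intro N2 st subspace_diff[OF V])
    qed
    also have "\<dots> \<le> s * (L * ?d u v) + t * (L * ?d u w)"
      using st fL uvw xyz(1) by (intro add_mono mult_left_mono) auto
    also have "\<dots> = L * (s * ?d u v + t * ?d u w)"
      by (simp add: algebra_simps)
    also have "\<dots> \<le> L * (4/3 * e)"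
      using e L by (rule mult_left_mono)
    finally show ?thesis by (simp add: algebra_simps)
  qed
  have l: "l = 1 - m - k" using lmk by simp
  have "f x - p = m *\<^sub>R (f x - f y) + k *\<^sub>R (f x - f z)"
    unfolding p_def l by (simp add: algebra_simps)
  from near[OF this lmk(2,3), of a] have px: "N (f x - p) \<le> 4/3 * L * a"
    using bounds(1) by (simp add: sums)
  have "f y - p = l *\<^sub>R (f y - f x) + k *\<^sub>R (f y - f z)"
    unfolding p_def l by (simp add: algebra_simps)
  from near[OF this lmk(1,3), of b] have py: "N (f y - p) \<le> 4/3 * L * b"
    using bounds(2) by (simp add: comm sums)
  have "f z - p = l *\<^sub>R (f z - f x) + m *\<^sub>R (f z - f y)"
    unfolding p_def l by (simp add: algebra_simps)
  from near[OF this lmk(1,2), of c] have pz: "N (f z - p) \<le> 4/3 * L * c"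
    using bounds(3) by (simp add: comm sums)
  define A where "A u = (if u = x then a else if u = y then b else c)" for u
  have "\<exists>g. lipschitz_map (4/3 * L) Y (norm_metric V N) g \<and> (\<forall>u\<in>{x, y, z}. g u = f u)"
  proof (rule star_extension[where a = A, OF n])
    show "f \<in> {x, y, z} \<rightarrow> V" using fV by auto
    show "A u + A v \<le> ?d u v" if "u \<in> {x, y, z}" "v \<in> {x, y, z}" "u \<noteq> v" for u v
      using that xyz sums comm by (auto simp: A_def)
    show "N (f u - p) \<le> 4/3 * L * A u" if "u \<in> {x, y, z}" for u
      using that xyz px py pz by (auto simp: A_def)
  qed (use Y pV L nn in \<open>auto simp: A_def\<close>)
  then show ?thesis using xyz by simp
qed

lemma ext_const_three_point_le:
  assumes n: "norm_on V N" and X: "card (mspace X) = 3" and ext: "metric_extension X Y"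
    and f: "Lipschitz_continuous_map X (norm_metric V N) f"
  shows "ext_const X Y (norm_metric V N) f \<le> ennreal (4/3)"
proof -
  obtain L where "lipschitz_map L X (norm_metric V N) f"
    using f by (auto simp: Lipschitz_continuous_map_def lipschitz_map_def)
  then obtain g where "lipschitz_map (4/3 * Lip X (norm_metric V N) f) Y (norm_metric V N) g"
    "\<forall>x\<in>mspace X. g x = f x"
    using three_point_lipschitz_extension[OF n X ext Lip_lipschitz_map] by blast
  then show ?thesis
    unfolding ext_const_def by (intro Inf_lower CollectI exI[of _ "4/3"] conjI) auto
qed

section \<open>A hexagonal plane\<close>

text \<open>
  The plane of vectors of \<open>\<ell>\<^sub>1\<^sup>3\<close> with coordinate sum 0, parametrized by the first two coordinates.
  Its unit ball is a hexagon. The restriction to a plane matters: in the whole of \<open>\<ell>\<^sub>1\<^sup>3\<close> the origin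
  has distance 1 from each basis vector.
\<close>

definition hexagonal_norm :: "real \<times> real \<Rightarrow> real" where
  "hexagonal_norm q = \<bar>fst q\<bar> + \<bar>snd q\<bar> + \<bar>fst q + snd q\<bar>"

lemma hexagonal_norm_scaleR: "hexagonal_norm (c *\<^sub>R q) = \<bar>c\<bar> * hexagonal_norm q"
proof -
  have "\<bar>c * fst q + c * snd q\<bar> = \<bar>c\<bar> * \<bar>fst q + snd q\<bar>"
    by (metis abs_mult distrib_left)
  then show ?thesis
    unfolding hexagonal_norm_def fst_scaleR snd_scaleR real_scaleR_def
    by (metis abs_mult distrib_left)
qed

text \<open>
  In \<open>\<ell>\<^sub>1\<^sup>3\<close>, translated by a basis vector, the three points are the basis vectors, and
  \<open>2 \<bar>q\<^sub>i\<bar> + \<bar>q\<^sub>i - 1\<bar> \<ge> q\<^sub>i + 1\<close> is added up over the coordinates of a vector with coordinate sum 1.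
\<close>

lemma hexagonal_triangle_distance_sum:
  "4 \<le> hexagonal_norm (q - (1, 0)) + hexagonal_norm (q - (0, 1)) + hexagonal_norm q"
proof -
  obtain s t where "q = (s, t)" by (cases q)
  then show ?thesis by (simp add: hexagonal_norm_def)
qed

text \<open>
  Completeness is inherited from the Euclidean plane, since the hexagonal and the Euclidean norm are
  equivalent.
\<close>

lemma banach_on_hexagonal:
  fixes T :: "real \<times> real \<Rightarrow> 'e::real_vector"
  assumes T: "linear T" and "inj T"
  shows "banach_on (range T) (\<lambda>v. hexagonal_norm (inv T v))"
proof -
  let ?N = "\<lambda>v. hexagonal_norm (inv T v)"
  have i: "inv T (T q) = q" for q
    using \<open>inj T\<close> by simp
  have n: "norm_on (range T) ?N"
    unfolding norm_on_def
  proof (intro conjI ballI allI)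
    show "subspace (range T)"
      by (simp add: T linear_subspace_image)
    fix v assume "v \<in> range T"
    then obtain q where q: "v = T q" by auto
    show "0 \<le> ?N v" by (simp add: hexagonal_norm_def)
    have "hexagonal_norm q = 0 \<longleftrightarrow> q = 0"
      by (auto simp: hexagonal_norm_def prod_eq_iff)
    moreover have "v = 0 \<longleftrightarrow> q = 0"
      unfolding q using linear_0[OF T] injD[OF assms(2), of q 0] by auto
    ultimately show "?N v = 0 \<longleftrightarrow> v = 0"
      by (simp add: q i)
    show "?N (c *\<^sub>R v) = \<bar>c\<bar> * ?N v" for c
      by (simp add: q i linear_scale[OF T, symmetric] hexagonal_norm_scaleR)
    fix w assume "w \<in> range T"
    then obtain q' where q': "w = T q'" by auto
    show "?N (v + w) \<le> ?N v + ?N w"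
      unfolding q q' i linear_add[OF T, symmetric] by (simp add: hexagonal_norm_def)
  qed
  have dd: "mdist (norm_metric (range T) ?N) (T q) (T q') = hexagonal_norm (q - q')" for q q'
    by (simp add: mdist_norm_metric[OF n] i linear_diff[OF T, symmetric])
  have "norm q \<le> hexagonal_norm q" for q
    using norm_Pair_le[of "fst q" "snd q"] by (simp add: hexagonal_norm_def)
  then have lower: "dist q q' \<le> hexagonal_norm (q - q')" for q q'
    by (simp add: dist_norm)
  have "hexagonal_norm q \<le> 4 * norm q" for q
    using norm_fst_le[of "fst q" "snd q"] norm_snd_le[of "snd q" "fst q"]
    by (simp add: hexagonal_norm_def)
  then have upper: "hexagonal_norm (q - q') \<le> 4 * dist q q'" for q q'
    by (simp add: dist_norm)
  interpret M: Metric_space "range T" "mdist (norm_metric (range T) ?N)"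
    using Metric_space_mspace_mdist mspace_norm_metric[OF n] by metis
  have "M.mcomplete"
    unfolding M.mcomplete_def
  proof (intro allI impI)
    fix s assume s: "M.MCauchy s"
    define q where "q k = inv T (s k)" for k
    have sq: "s k = T (q k)" for k
      using s unfolding M.MCauchy_def q_def by (metis f_inv_into_f rangeI subsetD)
    have "Cauchy q"
    proof (rule metric_CauchyI)
      fix \<epsilon> :: real assume "0 < \<epsilon>"
      then obtain k where "hexagonal_norm (q m - q n) < \<epsilon>" if "k \<le> m" "k \<le> n" for m n
        using s unfolding M.MCauchy_def sq dd by blast
      then show "\<exists>k. \<forall>m\<ge>k. \<forall>n\<ge>k. dist (q m) (q n) < \<epsilon>"
        using order_le_less_trans[OF lower] by blast
    qed
    then obtain l where "q \<longlonglongrightarrow> l"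
      using Cauchy_convergent convergent_def by blast
    then have lim: "(\<lambda>k. 4 * dist (q k) l) \<longlonglongrightarrow> 0"
      by (intro tendsto_mult_right_zero tendsto_dist_iff[THEN iffD1])
    have "norm (hexagonal_norm (q k - l)) \<le> 4 * dist (q k) l" for k
      using upper[of "q k" l] by (simp add: hexagonal_norm_def)
    then have "(\<lambda>k. hexagonal_norm (q k - l)) \<longlonglongrightarrow> 0"
      by (intro Lim_null_comparison[OF _ lim] always_eventually allI)
    then have "limitin M.mtopology s (T l) sequentially"
      unfolding M.limitin_metric_dist_null sq dd by simp
    then show "\<exists>v. limitin M.mtopology s v sequentially" ..
  qed
  then show ?thesis
    using n by (simp add: banach_on_def mcomplete_of_def mspace_norm_metric)
qed

lemma exists_linear_inj_plane:
  assumes "\<exists>B :: 'e::real_vector set. independent B \<and> infinite B"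
  obtains T :: "real \<times> real \<Rightarrow> 'e::real_vector" where "linear T" "inj T"
proof -
  obtain B :: "'e set" where B: "independent B" "infinite B" using assms by blast
  obtain C where C: "C \<subseteq> B" "card C = 2" using infinite_arbitrarily_large[OF B(2)] by blast
  then obtain u v where "C = {u, v}" "u \<noteq> v" unfolding card_2_iff by blast
  then have uv: "independent {u, v}" "u \<noteq> v"
    using independent_mono[OF B(1) C(1)] by simp_all
  define T where "T q = fst q *\<^sub>R u + snd q *\<^sub>R v" for q :: "real \<times> real"
  have lin: "linear T"
    by (rule linearI) (auto simp: T_def algebra_simps)
  have "q = 0" if "T q = 0" for q
  proof -
    let ?c = "\<lambda>w. if w = u then fst q else snd q"
    have "(\<Sum>w\<in>{u, v}. ?c w *\<^sub>R w) = 0" using that uv(2) by (simp add: T_def)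
    then have "\<forall>w\<in>{u, v}. ?c w = 0"
      using independentD[OF uv(1), of "{u, v}" ?c] by blast
    then show ?thesis using uv(2) by (auto simp: prod_eq_iff split: if_splits)
  qed
  then have "inj T" using linear_injective_0[OF lin] by blast
  with lin show thesis by (rule that)
qed

section \<open>The lower bound\<close>

lemma Metric_space_equilateral_with_centre:
  "Metric_space M (\<lambda>x y. if x = y then 0 else if x = o' \<or> y = o' then 1 else (2 :: real))"
  by standard auto

text \<open>
  The witness is the map of an equilateral triangle of side 2 onto the points \<open>(1, 0)\<close>, \<open>(0, 1)\<close> and 0
  of the hexagonal plane, which have mutual distance 2, together with an added centre at distance 1
  from the vertices.
\<close>

lemma ext_const_equilateral_ge:
  assumes "infinite (UNIV :: 'a set)"
    and "\<exists>B :: 'e::real_vector set. independent B \<and> infinite B"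
  obtains X Y :: "'a metric" and V :: "'e::real_vector set" and N f where "finite (mspace X)" "card (mspace X) = 3"
    "metric_extension X Y" "banach_on V N" "Lipschitz_continuous_map X (norm_metric V N) f"
    "ennreal (4/3) \<le> ext_const X Y (norm_metric V N) f"
proof -
  obtain S :: "'a set" where S: "finite S" "card S = 3"
    using infinite_arbitrarily_large[OF assms(1), of 3] by auto
  then obtain o' where o': "o' \<notin> S"
    using ex_new_if_finite[OF assms(1)] by auto
  obtain x y z where "S = {x, y, z}" and xyz: "x \<noteq> y" "x \<noteq> z" "y \<noteq> z"
    using S(2)[unfolded card_3_iff] by (elim exE conjE)
  then have dist: "o' \<noteq> x" "o' \<noteq> y" "o' \<noteq> z" "x \<noteq> y" "x \<noteq> z" "y \<noteq> z"
    using o' by auto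
  define d where "d u v = (if u = v then 0 else if u = o' \<or> v = o' then 1 else (2 :: real))" for u v
  have M: "Metric_space M d" for M
    using Metric_space_equilateral_with_centre[of M o'] unfolding d_def .
  define X where "X = metric ({x, y, z}, d)"
  define Y where "Y = metric ({x, y, z, o'}, d)"
  have X: "mspace X = {x, y, z}" "mdist X = d"
    using M by (simp_all add: X_def Metric_space.mspace_metric Metric_space.mdist_metric)
  have Y: "mspace Y = {x, y, z, o'}" "mdist Y = d"
    using M by (simp_all add: Y_def Metric_space.mspace_metric Metric_space.mdist_metric)
  obtain T :: "real \<times> real \<Rightarrow> 'e" where T: "linear T" "inj T"
    by (rule exists_linear_inj_plane[OF assms(2)])
  let ?N = "\<lambda>v. hexagonal_norm (inv T v)"
  let ?E = "norm_metric (range T) ?N"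
  have E: "banach_on (range T) ?N" using T by (rule banach_on_hexagonal)
  then have n: "norm_on (range T) ?N" by (simp add: banach_on_def)
  have dd: "mdist ?E (T q) (T q') = hexagonal_norm (q - q')" for q q'
    by (simp add: mdist_norm_metric[OF n] inv_f_f[OF T(2)] linear_diff[OF T(1), symmetric])
  define f where "f u = T (if u = x then (1, 0) else if u = y then (0, 1) else 0)" for u
  have hex: "hexagonal_norm (s, t) = \<bar>s\<bar> + \<bar>t\<bar> + \<bar>s + t\<bar>" "hexagonal_norm 0 = 0" for s t
    by (simp_all add: hexagonal_norm_def)
  have f1: "lipschitz_map 1 X ?E f"
    unfolding lipschitz_map_def X mspace_norm_metric[OF n]
    using dist by (auto simp: f_def dd d_def hex)
  have "4/3 \<le> K"
    if K: "0 \<le> K" and g: "lipschitz_map (K * Lip X ?E f) Y ?E g" "\<forall>u\<in>mspace X. g u = f u" for K g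
  proof -
    obtain q where q: "g o' = T q"
      using g(1) by (auto simp: lipschitz_map_def Y mspace_norm_metric[OF n])
    have "mdist ?E (g o') (f u) \<le> K" if u: "u \<in> {x, y, z}" for u
    proof -
      have "mdist ?E (g o') (g u) \<le> K * Lip X ?E f * d o' u"
        using g(1) u unfolding lipschitz_map_def Y by blast
      also have "\<dots> \<le> K * 1"
        using u dist K mult_left_mono[OF Lip_le[OF _ f1] K] by (auto simp: d_def)
      finally show ?thesis using g(2) u X by auto
    qed
    from this[of x] this[of y] this[of z]
    have "hexagonal_norm (q - (1, 0)) \<le> K" "hexagonal_norm (q - (0, 1)) \<le> K" "hexagonal_norm q \<le> K"
      using dist dd[of q 0] by (simp_all add: q f_def dd)
    then show ?thesis using hexagonal_triangle_distance_sum[of q] by linarith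
  qed
  then have "ennreal (4/3) \<le> ext_const X Y ?E f"
    unfolding ext_const_def by (intro Inf_greatest) (auto intro: ennreal_leI)
  moreover have "Lipschitz_continuous_map X ?E f"
    using f1 unfolding Lipschitz_continuous_map_def lipschitz_map_def by blast
  moreover have "metric_extension X Y"
    by (auto simp: metric_extension_def X Y)
  moreover have "finite (mspace X)" "card (mspace X) = 3"
    using dist by (simp_all add: X)
  ultimately show thesis using that E by blast
qed

theorem proposition1p5:
  assumes "infinite (UNIV :: 'a set)"
    and "\<exists>B :: 'e::real_vector set. independent B \<and> infinite B"
  shows "ae TYPE('a) TYPE('e) 3 = ennreal (4 / 3)"
proof (rule antisym)
  show "ae TYPE('a) TYPE('e) 3 \<le> ennreal (4 / 3)"
    unfolding ae_def ae_space_def nu_def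
    by (intro Sup_least) (auto intro!: Sup_least ext_const_three_point_le simp: banach_on_def)
next
  obtain X Y :: "'a metric" and V :: "'e::real_vector set" and N f where
    X: "finite (mspace X)" "card (mspace X) = 3" and Y: "metric_extension X Y"
    and V: "banach_on V N" "Lipschitz_continuous_map X (norm_metric V N) f"
    and ge: "ennreal (4/3) \<le> ext_const X Y (norm_metric V N) f"
    using ext_const_equilateral_ge[OF assms] .
  note ge
  also have "ext_const X Y (norm_metric V N) f \<le> nu TYPE('e) X Y"
    unfolding nu_def using V by (intro Sup_upper) blast
  also have "\<dots> \<le> ae_space TYPE('e) X"
    unfolding ae_space_def using Y by (intro Sup_upper) blast
  also have "\<dots> \<le> ae TYPE('a) TYPE('e) 3"
    unfolding ae_def using X by (intro Sup_upper) blast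
  finally show "ennreal (4 / 3) \<le> ae TYPE('a) TYPE('e) 3" .
qed

end
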